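(* Let $\Delta=\{\alpha(0),\alpha(1),\dots,\alpha(n)\}\subset(2\mathbb{N})^n$, with $\alpha(0)=0$, be a full-dimensional simplicial set (i.e. the vertex set of an $n$-simplex), and let $Y=\{\beta_1,\dots,\beta_m\}\subseteq\operatorname{Int}(\operatorname{conv}(\Delta))\cap\mathbb{Z}^n$ be a set of points. Let $$f=\sum_{i=0}^n a_i x^{\alpha(i)}+\sum_{\beta\in Y}b_\beta x^\beta\in\mathbb{R}[x_1,\dots,x_n]$$ be a sum of nonnegative circuit polynomials (SONC) with support $\Delta\cup Y$ and $a_0,\dots,a_n>0$, such that for every $\beta\in Y$ one has $b_\beta<0$ or $\beta\notin(2\mathbb{Z})^n$. Then $f$ is a sum of squares of real polynomials if and only if every $\beta\in Y$ satisfies $\beta\in\Delta^*$.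
   Context: Here $\mathbb{N}=\{0,1,2,\dots\}$ and $x^\alpha=x_1^{\alpha_1}\cdots x_n^{\alpha_n}$. The support of a polynomial is the set of exponents with nonzero coefficient. For $L\subseteq\mathbb{Z}^n$ put $\operatorname{Mid}(L)=\{\tfrac{s+t}{2} : s,t\in L\cap(2\mathbb{Z})^n,\ s\neq t\}$. For a finite set $\Delta\subset(2\mathbb{Z})^n$, a set $L\subseteq\mathbb{Z}^n$ is $\Delta$-mediated if $\Delta\subseteq L\subseteq\operatorname{Mid}(L)\cup\Delta$. The maximal $\Delta$-mediated set $\Delta^*$ is the (unique, existing) $\Delta$-mediated set containing every $\Delta$-mediated set; it satisfies $\Delta\cup\operatorname{Mid}(\Delta)\subseteq\Delta^*\subseteq\operatorname{conv}(\Delta)\cap\mathbb{Z}^n$. A circuit polynomial is a polynomial $p\in\mathbb{R}[x_1,\dots,x_n]$ of the form $p=c_\beta x^\beta+\sum_{j=0}^r c_{\gamma(j)}x^{\gamma(j)}$ with $r\le n$, $\gamma(j),\beta\in\mathbb{N}^n$, $c_{\gamma(j)}>0$, $c_\beta\in\mathbb{R}$, such that its Newton polytope (convex hull of the exponents) is a simplex with vertices $\gamma(0),\dots,\gamma(r)\in(2\mathbb{N})^n$ and $\beta$ lies in the (relative) interior of the Newton polytope. A circuit polynomial is nonnegative if $p(x)\ge0$ for all $x\in\mathbb{R}^n$. A polynomial is SONC (a sum of nonnegative circuit polynomials) if it is a finite sum of nonnegative circuit polynomials.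
   Formalization: Δ-mediated sets are required to be finite; without this, all of ℤⁿ would be Δ-mediated, so Δ* would be ℤⁿ, contradicting Δ* ⊆ conv(Δ) and making the claim false (e.g. for the Motzkin polynomial). *)

theory Defs
  imports "HOL-Analysis.Analysis" "HOL-Library.Poly_Mapping"
begin

text \<open>
  Points of \<open>\<nat>\<close>-, \<open>\<int>\<close>- and \<open>\<real>\<close>-coordinate space are vectors indexed by a finite type
  \<open>'n\<close>, so that the dimension is \<open>CARD('n)\<close>.  The polynomial ring in the variables indexed by
  \<open>'n\<close> is the monoid algebra over the exponents \<open>nat ^ 'n\<close>; the support of a polynomial is its
  set of \<open>keys\<close>, and \<open>Poly_Mapping.single e c\<close> is the term with exponent \<open>e\<close> and
  coefficient \<open>c\<close>.
\<close>

type_synonym 'n mpolynomial = "(nat ^ 'n) \<Rightarrow>\<^sub>0 real"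

definition int_point :: "nat ^ 'n \<Rightarrow> int ^ 'n" where
  "int_point e = (\<chi> i. int (e $ i))"

definition real_point :: "int ^ 'n \<Rightarrow> real ^ 'n" where
  "real_point z = (\<chi> i. real_of_int (z $ i))"

definition even_lattice :: "(int ^ 'n) set" where
  "even_lattice = {z. \<forall>i. even (z $ i)}"


subsection \<open>Mediated sets\<close>

text \<open>The division is exact, as \<open>s\<close> and \<open>t\<close> have even coordinates.\<close>

definition Mid :: "(int ^ 'n) set \<Rightarrow> (int ^ 'n) set" where
  "Mid L = {(\<chi> i. (s $ i + t $ i) div 2) | s t.
              s \<in> L \<inter> even_lattice \<and> t \<in> L \<inter> even_lattice \<and> s \<noteq> t}"

text \<open>
  Mediated sets are finite.  Without this condition the whole lattice would be mediated for every
  \<open>\<Delta>\<close>, and the largest mediated set would not lie in the convex hull of \<open>\<Delta>\<close>.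
\<close>

definition mediated :: "(int ^ 'n) set \<Rightarrow> (int ^ 'n) set \<Rightarrow> bool" where
  "mediated \<Delta> L \<longleftrightarrow> finite L \<and> \<Delta> \<subseteq> L \<and> L \<subseteq> Mid L \<union> \<Delta>"

definition maximal_mediated :: "(int ^ 'n) set \<Rightarrow> (int ^ 'n) set" where
  "maximal_mediated \<Delta> = (GREATEST L. mediated \<Delta> L)"

text \<open>The greatest element exists for every finite \<open>\<Delta>\<close>, and lies in its convex hull:\<close>

lemma mediated_subset_convex_hull:
  fixes \<Delta> L :: "(int ^ 'n) set"
  assumes "mediated \<Delta> L"
  shows "real_point ` L \<subseteq> convex hull (real_point ` \<Delta>)"
proof -
  let ?C = "convex hull (real_point ` L)"
  have fin: "finite (real_point ` L)" and L: "L \<subseteq> Mid L \<union> \<Delta>"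
    using assms by (auto simp: mediated_def)
  have "x \<in> real_point ` \<Delta>" if x: "x extreme_point_of ?C" for x
  proof (rule ccontr)
    assume *: "x \<notin> real_point ` \<Delta>"
    obtain z where z: "z \<in> L" "x = real_point z"
      using extreme_point_of_convex_hull [OF x] by auto
    with * L have "z \<in> Mid L" by auto
    then obtain s t where st: "s \<in> L" "t \<in> L" "s \<in> even_lattice" "t \<in> even_lattice" "s \<noteq> t"
      and z_eq: "z = (\<chi> i. (s $ i + t $ i) div 2)" by (auto simp: Mid_def)
    have "x = midpoint (real_point s) (real_point t)"
      using st z z_eq
      by (auto simp: real_point_def even_lattice_def midpoint_def vec_eq_iff
          real_of_int_div field_simps)
    moreover have "real_point s \<noteq> real_point t"
      using st(5) by (auto simp: real_point_def vec_eq_iff)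
    ultimately have "x \<in> open_segment (real_point s) (real_point t)"
      by simp
    moreover have "real_point s \<in> ?C" "real_point t \<in> ?C"
      using st by (auto intro: hull_inc)
    ultimately show False using x unfolding extreme_point_of_def by blast
  qed
  then have "convex hull {x. x extreme_point_of ?C} \<subseteq> convex hull (real_point ` \<Delta>)"
    by (intro hull_mono) auto
  then show ?thesis
    using Krein_Milman_polytope [OF fin] hull_subset [of "real_point ` L" convex] by blast
qed

lemma finite_bounded_lattice_points:
  fixes S :: "(real ^ 'n) set"
  assumes "bounded S"
  shows "finite {z. real_point z \<in> S}"
proof -
  obtain k where k: "\<And>x. x \<in> S \<Longrightarrow> norm x \<le> k"
    using assms by (auto simp: bounded_iff)
  have "\<bar>z $ i\<bar> \<le> \<lceil>k\<rceil>" if "real_point z \<in> S" for z i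
  proof -
    have "\<bar>real_of_int (z $ i)\<bar> \<le> k"
      using component_le_norm_cart [of "real_point z" i] k [OF that]
      by (simp add: real_point_def)
    then show ?thesis by linarith
  qed
  then have "vec_nth ` {z. real_point z \<in> S} \<subseteq> PiE UNIV (\<lambda>_. {-\<lceil>k\<rceil>..\<lceil>k\<rceil>})"
    by (force simp: PiE_UNIV_domain abs_le_iff)
  then have "finite (vec_nth ` {z. real_point z \<in> S})"
    by (rule finite_subset) (simp add: finite_PiE)
  then show ?thesis
    by (rule finite_imageD) (simp add: inj_on_def vec_nth_inject)
qed

lemma
  fixes \<Delta> :: "(int ^ 'n) set"
  assumes "finite \<Delta>"
  shows mediated_maximal_mediated: "mediated \<Delta> (maximal_mediated \<Delta>)"
    and maximal_mediated_greatest: "mediated \<Delta> L \<Longrightarrow> L \<subseteq> maximal_mediated \<Delta>"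
proof -
  let ?M = "\<Union>{L. mediated \<Delta> L}"
  have "?M \<subseteq> {z. real_point z \<in> convex hull (real_point ` \<Delta>)}"
    using mediated_subset_convex_hull by blast
  moreover have "bounded (convex hull (real_point ` \<Delta>))"
    using assms by (simp add: bounded_convex_hull finite_imp_bounded)
  ultimately have fin: "finite ?M"
    by (rule finite_subset [OF _ finite_bounded_lattice_points])
  have "mediated \<Delta> \<Delta>"
    using assms by (simp add: mediated_def)
  then have sub: "\<Delta> \<subseteq> ?M" by blast
  have Mid_mono: "Mid L \<subseteq> Mid ?M" if "mediated \<Delta> L" for L
  proof -
    from that have "L \<subseteq> ?M" by (simp add: Union_upper)
    then show ?thesis unfolding Mid_def by blast
  qed
  have "?M \<subseteq> Mid ?M \<union> \<Delta>"
  proof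
    fix z assume "z \<in> ?M"
    then obtain L where L: "mediated \<Delta> L" "z \<in> L" by auto
    then have "z \<in> Mid L \<union> \<Delta>" by (auto simp: mediated_def)
    then show "z \<in> Mid ?M \<union> \<Delta>" using Mid_mono [OF L(1)] by (meson UnE UnI1 UnI2 subsetD)
  qed
  with fin sub have M: "mediated \<Delta> ?M"
    by (simp add: mediated_def)
  have "maximal_mediated \<Delta> = ?M"
    unfolding maximal_mediated_def by (rule Greatest_equality [where P = "mediated \<Delta>", OF M]) (simp add: Union_upper)
  then show "mediated \<Delta> (maximal_mediated \<Delta>)" "mediated \<Delta> L \<Longrightarrow> L \<subseteq> maximal_mediated \<Delta>"
    using M by (simp_all add: Union_upper)
qed


subsection \<open>Polynomials\<close>

definition evaluate :: "'n::finite mpolynomial \<Rightarrow> real ^ 'n \<Rightarrow> real" where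
  "evaluate p x = (\<Sum>e\<in>Poly_Mapping.keys p. Poly_Mapping.lookup p e * (\<Prod>i\<in>UNIV. (x $ i) ^ (e $ i)))"

definition nonnegative :: "'n::finite mpolynomial \<Rightarrow> bool" where
  "nonnegative p \<longleftrightarrow> (\<forall>x. evaluate p x \<ge> 0)"

definition newton_polytope :: "'n::finite mpolynomial \<Rightarrow> (real ^ 'n) set" where
  "newton_polytope p = convex hull (real_point ` int_point ` Poly_Mapping.keys p)"

text \<open>
  The points \<open>\<gamma> 0, \<dots>, \<gamma> r\<close> are pairwise distinct and affinely independent, i.e. they are the
  vertices of the \<open>r\<close>-simplex which is their convex hull.  The case \<open>r = 0\<close> is included: then
  \<open>\<beta> = \<gamma> 0\<close> and \<open>p\<close> is a single term with even exponent.
\<close>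

definition circuit_polynomial :: "'n::finite mpolynomial \<Rightarrow> bool" where
  "circuit_polynomial p \<longleftrightarrow>
    (\<exists>(r::nat) (\<gamma> :: nat \<Rightarrow> nat ^ 'n) (c :: nat \<Rightarrow> real) (\<beta> :: nat ^ 'n) (d :: real).
      r \<le> CARD('n) \<and>
      p = Poly_Mapping.single \<beta> d + (\<Sum>j\<le>r. Poly_Mapping.single (\<gamma> j) (c j)) \<and>
      (\<forall>j\<le>r. c j > 0) \<and>
      (\<forall>j\<le>r. int_point (\<gamma> j) \<in> even_lattice) \<and>
      inj_on \<gamma> {..r} \<and>
      \<not> affine_dependent (real_point ` int_point ` \<gamma> ` {..r}) \<and>
      newton_polytope p = convex hull (real_point ` int_point ` \<gamma> ` {..r}) \<and>
      real_point (int_point \<beta>) \<in> rel_interior (newton_polytope p))"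

definition SONC :: "'n::finite mpolynomial \<Rightarrow> bool" where
  "SONC p \<longleftrightarrow>
    (\<exists>ps. (\<forall>q\<in>set ps. circuit_polynomial q \<and> nonnegative q) \<and> p = sum_list ps)"

definition sum_of_squares :: "'n::finite mpolynomial \<Rightarrow> bool" where
  "sum_of_squares p \<longleftrightarrow> (\<exists>qs. p = (\<Sum>q\<leftarrow>qs. q ^ 2))"

end

theory Submission imports Defs begin

text \<open>
  Necessity is a count of coefficients.  In \<open>f = \<Sum> q\<^sup>2\<close> an exponent with negative coefficient, one that
  is not even, and one whose coefficient cancels must each arise from a cross term, hence be the midpoint
  of two distinct even exponents \<open>2u\<close> and \<open>2v\<close>, where \<open>u\<close> and \<open>v\<close> are exponents of one of the \<open>q\<close>.  Adding all
  these doubled exponents to the support of \<open>f\<close> gives a mediated set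
  (\<open>sum_of_squares_keys_mediated\<close>).

  For sufficiency, \<open>f\<close> is split into circuit polynomials with the given simplex as Newton polytope, one
  for each \<open>\<beta> \<in> Y\<close>, and each of them is written as a sum of squares.

  The splitting uses the SONC property only through one inequality.  A circuit polynomial has at most
  one exponent that is not even, so on the positive orthant a nonnegative one stays nonnegative when the
  corresponding term is given a negative sign.  Summing up, the polynomial
  \<open>\<Sum> a\<^sub>i x\<^bsup>\<alpha>(i)\<^esup> - \<Sum> \<bar>b\<^sub>\<beta>\<bar> x\<^sup>\<beta>\<close> is nonnegative on the positive orthant
  (\<open>SONC_orthant_minorant_nonneg\<close>), whatever other exponents the circuits contained and
  however they cancelled.  The monomials of the vertices, up to a common factor, are independent
  positive coordinates \<open>w\<^sub>i\<close> on the orthant, in which \<open>x\<^sup>\<beta>\<close> is the product of the \<open>w\<^sub>i\<close> raised to the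
  barycentric coordinates \<open>\<lambda>\<^sub>i\<close> of \<open>\<beta>\<close>.  Maximising the ratio of the negative to the
  positive part gives a point at which \<open>\<Sum>\<^sub>\<beta> \<bar>b\<^sub>\<beta>\<bar> x\<^sup>\<beta> \<lambda>\<^sub>i(\<beta>) \<le> a\<^sub>i x\<^bsup>\<alpha>(i)\<^esup>\<close> for every \<open>i\<close>
  (\<open>exponential_critical_point\<close>).  This says exactly how much of \<open>a\<^sub>i\<close> to assign to \<open>\<beta>\<close>: the resulting circuit
  polynomial is a weighted inequality of arithmetic and geometric means with equality at that point.

  Such an inequality is a sum of squares if \<open>\<beta>\<close> lies in the maximal mediated set.  If a
  point \<open>z\<close> of that set is the midpoint of \<open>2u\<close> and \<open>2v\<close>, then \<open>x\<^sup>z\<close> is the mean of \<open>x\<close> to the powers \<open>2u\<close> and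
  \<open>2v\<close> minus half a square.  These relations form a linear system that
  expresses the monomials of the mediated set by those of the vertices; Gaussian elimination,
  one point at a time, keeps all weights nonnegative and all remainders sums of squares
  (\<open>dominates_avoiding\<close>).
\<close>

section \<open>Exponent vectors and coefficients\<close>

abbreviation rvec :: "nat ^ 'n \<Rightarrow> real ^ 'n" where
  "rvec e \<equiv> real_point (int_point e)"

lemma rvec_nth: "rvec e $ i = real (e $ i)"
  by (simp add: real_point_def int_point_def)

lemma rvec_add: "rvec (u + v) = rvec u + rvec v"
  by (simp add: vec_eq_iff rvec_nth)

lemma inj_int_point: "inj int_point"
  by (auto simp: inj_on_def int_point_def vec_eq_iff)

lemma inj_rvec: "inj rvec"
  by (auto simp: inj_on_def vec_eq_iff rvec_nth)

lemma double_eq_iff: "u + u = v + v \<longleftrightarrow> u = v" for u v :: "nat ^ 'n"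
  by (auto simp: vec_eq_iff simp flip: mult_2)

lemma int_point_even_iff: "int_point e \<in> even_lattice \<longleftrightarrow> (\<exists>u. e = u + u)"
proof
  assume "int_point e \<in> even_lattice"
  then have ev: "even (e $ i)" for i
    by (simp add: even_lattice_def int_point_def)
  have "e = (\<chi> i. e $ i div 2) + (\<chi> i. e $ i div 2)"
    using ev by (simp add: vec_eq_iff flip: mult_2)
  then show "\<exists>u. e = u + u" ..
qed (auto simp: even_lattice_def int_point_def)

lemma poly_mapping_eq_sum_single:
  assumes "finite A" "Poly_Mapping.keys p \<subseteq> A"
  shows "p = (\<Sum>e\<in>A. Poly_Mapping.single e (Poly_Mapping.lookup p e))"
  using assms by (intro poly_mapping_eqI) (auto simp: lookup_sum lookup_single when_def in_keys_iff)

lemma single_sum: "Poly_Mapping.single e (\<Sum>i\<in>A. h i) = (\<Sum>i\<in>A. Poly_Mapping.single e (h i))"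
  by (induction A rule: infinite_finite_induct) (simp_all add: single_add)

section \<open>Squares and sums of squares\<close>

lemma lookup_square:
  "Poly_Mapping.lookup (q ^ 2) e =
    (\<Sum>u\<in>Poly_Mapping.keys q. \<Sum>v\<in>Poly_Mapping.keys q.
      Poly_Mapping.lookup q u * Poly_Mapping.lookup q v when u + v = e)"
  for q :: "'n::finite mpolynomial"
proof -
  let ?K = "Poly_Mapping.keys q" and ?c = "Poly_Mapping.lookup q"
  have "q ^ 2 = (\<Sum>u\<in>?K. Poly_Mapping.single u (?c u)) * (\<Sum>v\<in>?K. Poly_Mapping.single v (?c v))"
    using poly_mapping_eq_sum_single [of ?K q] by (simp add: power2_eq_square)
  also have "\<dots> = (\<Sum>u\<in>?K. \<Sum>v\<in>?K. Poly_Mapping.single (u + v) (?c u * ?c v))"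
    by (simp add: sum_product mult_single)
  finally show ?thesis
    by (simp add: lookup_sum lookup_single)
qed

text \<open>
  If the exponent \<open>e\<close> arises in \<open>q\<^sup>2\<close> only as \<open>u + u\<close>, no cross term can be subtracted: the
  coefficient at \<open>e\<close> is a square, and it vanishes when \<open>e\<close> is not even.
\<close>

lemma lookup_square_diagonal:
  fixes q :: "'n::finite mpolynomial"
  assumes "\<And>u v. u \<in> Poly_Mapping.keys q \<Longrightarrow> v \<in> Poly_Mapping.keys q \<Longrightarrow> u + v = e \<Longrightarrow> u = v"
  shows "Poly_Mapping.lookup (q ^ 2) e =
    (\<Sum>u\<in>Poly_Mapping.keys q. (Poly_Mapping.lookup q u)\<^sup>2 when u + u = e)"
proof -
  let ?K = "Poly_Mapping.keys q" and ?c = "Poly_Mapping.lookup q"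
  have "(\<Sum>v\<in>?K. ?c u * ?c v when u + v = e) = ((?c u)\<^sup>2 when u + u = e)" if u: "u \<in> ?K" for u
  proof -
    have "(\<Sum>v\<in>?K. ?c u * ?c v when u + v = e) =
          (\<Sum>v\<in>?K. if v = u then (?c u)\<^sup>2 when u + u = e else 0)"
      using assms u by (intro sum.cong refl) (auto simp: when_def power2_eq_square)
    then show ?thesis using u by simp
  qed
  then show ?thesis by (simp add: lookup_square)
qed

lemma sum_of_squares_zero: "sum_of_squares 0"
  unfolding sum_of_squares_def by (intro exI [of _ "[]"]) simp

lemma sum_of_squares_square: "sum_of_squares (q ^ 2)"
  unfolding sum_of_squares_def by (intro exI [of _ "[q]"]) simp

lemma sum_of_squares_add:
  assumes "sum_of_squares p" "sum_of_squares q"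
  shows "sum_of_squares (p + q)"
proof -
  from assms obtain ps qs where "p = (\<Sum>r\<leftarrow>ps. r ^ 2)" "q = (\<Sum>r\<leftarrow>qs. r ^ 2)"
    by (auto simp: sum_of_squares_def)
  then show ?thesis
    unfolding sum_of_squares_def by (intro exI [of _ "ps @ qs"]) simp
qed

lemma sum_of_squares_sum:
  assumes "\<And>i. i \<in> A \<Longrightarrow> sum_of_squares (p i)"
  shows "sum_of_squares (\<Sum>i\<in>A. p i)"
  using assms
  by (induction A rule: infinite_finite_induct)
    (auto intro: sum_of_squares_zero sum_of_squares_add)

lemma sum_of_squares_scale:
  assumes "sum_of_squares p" "r \<ge> 0"
  shows "sum_of_squares (Poly_Mapping.single 0 r * p)"
proof -
  from assms obtain ps where "p = (\<Sum>q\<leftarrow>ps. q ^ 2)"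
    by (auto simp: sum_of_squares_def)
  moreover have "Poly_Mapping.single 0 r = Poly_Mapping.single (0 :: nat ^ 'a) (sqrt r) ^ 2"
    using assms(2) by (simp add: power2_eq_square mult_single)
  ultimately have "Poly_Mapping.single 0 r * p =
      (\<Sum>q\<leftarrow>map (\<lambda>q. Poly_Mapping.single 0 (sqrt r) * q) ps. q ^ 2)"
    by (simp add: sum_list_const_mult power_mult_distrib o_def)
  then show ?thesis unfolding sum_of_squares_def by blast
qed

lemma sum_of_squares_even_term:
  assumes "r \<ge> 0"
  shows "sum_of_squares (Poly_Mapping.single (u + u) r)"
proof -
  have "Poly_Mapping.single (u + u) r = Poly_Mapping.single u (sqrt r) ^ 2"
    using assms by (simp add: power2_eq_square mult_single)
  then show ?thesis using sum_of_squares_square by metis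
qed

section \<open>Exponents of a sum of squares\<close>

lemma in_Mid_int_point:
  assumes "int_point (u + u) \<in> L" "int_point (v + v) \<in> L" "u \<noteq> v"
  shows "int_point (u + v) \<in> Mid L"
proof -
  have "int_point (u + u) \<noteq> int_point (v + v)"
    using assms(3) double_eq_iff inj_int_point by (metis injD)
  moreover have "int_point (u + v) = (\<chi> i. (int_point (u + u) $ i + int_point (v + v) $ i) div 2)"
    by (simp add: int_point_def vec_eq_iff)
  moreover have "int_point (u + u) \<in> even_lattice" "int_point (v + v) \<in> even_lattice"
    by (auto simp: int_point_even_iff)
  ultimately show ?thesis
    using assms(1,2) unfolding Mid_def by blast
qed

text \<open>
  Let \<open>C\<close> collect the exponents of the polynomials \<open>q\<close> in a representation \<open>f = \<Sum> q\<^sup>2\<close>.  Then the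
  exponents of \<open>f\<close>, the points of \<open>D\<close> and the doubles of the points of \<open>C\<close> together form a
  mediated set.  Indeed, suppose that a point \<open>e\<close> of it outside \<open>D\<close> were not of the form
  \<open>u + v\<close> with distinct exponents \<open>u\<close>, \<open>v\<close> of one \<open>q\<close>.  Then the coefficient of \<open>f\<close> at \<open>e\<close> would be
  a sum of squares of coefficients: nonnegative, zero if \<open>e\<close> is not even, and positive if \<open>e\<close> is the
  double of a point of \<open>C\<close>.  This is impossible, both for an exponent of \<open>f\<close>, by the sign condition,
  and for a doubled point that is not an exponent of \<open>f\<close>.  So \<open>e\<close> is the midpoint of \<open>u + u\<close> and \<open>v + v\<close>.
\<close>

theorem sum_of_squares_keys_mediated:
  fixes f :: "'n::finite mpolynomial"
  assumes sos: "sum_of_squares f"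
    and D: "finite D"
    and sgn: "\<And>e. e \<in> Poly_Mapping.keys f - D \<Longrightarrow>
      Poly_Mapping.lookup f e < 0 \<or> int_point e \<notin> even_lattice"
  shows "int_point ` Poly_Mapping.keys f \<subseteq> maximal_mediated (int_point ` D)"
proof -
  let ?keys = Poly_Mapping.keys and ?lookup = Poly_Mapping.lookup
  obtain qs where f: "f = (\<Sum>q\<leftarrow>qs. q ^ 2)"
    using sos by (auto simp: sum_of_squares_def)
  have lookup_f: "?lookup f e = (\<Sum>q\<leftarrow>qs. ?lookup (q ^ 2) e)" for e
    unfolding f by (induction qs) (simp_all add: lookup_add)
  define C where "C = (\<Union>q\<in>set qs. ?keys q)"
  define L where "L = D \<union> ?keys f \<union> (\<lambda>u. u + u) ` C"
  have cross: "\<exists>q\<in>set qs. \<exists>u\<in>?keys q. \<exists>v\<in>?keys q. u + v = e \<and> u \<noteq> v" if e: "e \<in> L - D" for e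
  proof (rule ccontr)
    assume "\<not> ?thesis"
    then have sq: "?lookup (q ^ 2) e = (\<Sum>u\<in>?keys q. (?lookup q u)\<^sup>2 when u + u = e)"
      if "q \<in> set qs" for q
      using that by (intro lookup_square_diagonal) blast
    then have nonneg: "?lookup (q ^ 2) e \<ge> 0" if "q \<in> set qs" for q
      using that by (auto intro!: sum_nonneg simp: when_def)
    then have nonneg_f: "?lookup f e \<ge> 0"
      unfolding lookup_f by (intro sum_list_nonneg) auto
    show False
    proof (cases "e \<in> ?keys f")
      case True
      with e sgn nonneg_f have "int_point e \<notin> even_lattice" by fastforce
      then have "u + u \<noteq> e" for u by (auto simp: int_point_even_iff)
      with sq have "?lookup (q ^ 2) e = 0" if "q \<in> set qs" for q
        using that by simp
      then have "?lookup f e = 0" unfolding lookup_f by (simp cong: map_cong)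
      with True show False by (simp add: in_keys_iff)
    next
      case False
      with e obtain q u where q: "q \<in> set qs" "u \<in> ?keys q" "e = u + u"
        by (auto simp: L_def C_def)
      have "0 < (?lookup q u)\<^sup>2"
        using q by (simp add: in_keys_iff)
      also have "\<dots> \<le> ?lookup (q ^ 2) e"
        unfolding sq [OF q(1)] using q
        by (intro order_trans [OF _ member_le_sum [of u]]) (auto simp: when_def)
      also have "\<dots> \<le> ?lookup f e"
        unfolding lookup_f using q nonneg by (intro member_le_sum_list) auto
      finally show False using False by (simp add: in_keys_iff)
    qed
  qed
  have "int_point e \<in> Mid (int_point ` L) \<union> int_point ` D" if "e \<in> L" for e
  proof (cases "e \<in> D")
    case False
    with cross that obtain q u v where "q \<in> set qs" "u \<in> ?keys q" "v \<in> ?keys q" "u + v = e" "u \<noteq> v"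
      by blast
    moreover from this have "u \<in> C" "v \<in> C" by (auto simp: C_def)
    ultimately show ?thesis
      using in_Mid_int_point [of u "int_point ` L" v] by (auto simp: L_def)
  qed auto
  moreover have "finite L" using D by (simp add: L_def C_def)
  ultimately have "mediated (int_point ` D) (int_point ` L)"
    by (auto simp: mediated_def L_def)
  then have "int_point ` L \<subseteq> maximal_mediated (int_point ` D)"
    using D by (intro maximal_mediated_greatest) auto
  then show ?thesis by (auto simp: L_def)
qed

section \<open>Critical points of signomials supported on a simplex\<close>

text \<open>
  Let \<open>H w\<close> be the left side of the assumed inequality, with \<open>Y\<close> nonempty.  It is homogeneous of degree one in the weights \<open>w\<close>,
  like the linear form on the right, so it may be maximised on the compact set \<open>K\<close> of
  nonnegative \<open>w\<close> at which the linear form equals \<open>1\<close>.  All exponents \<open>l b i\<close> are positive, hence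
  \<open>H\<close> is continuous up to the boundary and vanishes there, and the maximiser has positive entries.
  The Lagrange condition in the logarithmic coordinate of \<open>w i\<close> says that the left side of the
  conclusion is \<open>H w * (a i * w i)\<close>, and the maximum \<open>H w\<close> is at most \<open>1\<close>.
\<close>

lemma critical_weights:
  fixes I :: "'i set" and Y :: "'b set" and a :: "'i \<Rightarrow> real" and B :: "'b \<Rightarrow> real"
  assumes I: "finite I" and Y: "finite Y"
    and a: "\<And>i. i \<in> I \<Longrightarrow> a i > 0" and B: "\<And>b. b \<in> Y \<Longrightarrow> B b > 0"
    and l: "\<And>b i. b \<in> Y \<Longrightarrow> i \<in> I \<Longrightarrow> l b i > 0" and l1: "\<And>b. b \<in> Y \<Longrightarrow> sum (l b) I = 1"
    and le: "\<And>w. (\<And>i. i \<in> I \<Longrightarrow> w i > 0) \<Longrightarrow>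
      (\<Sum>b\<in>Y. B b * (\<Prod>i\<in>I. w i powr l b i)) \<le> (\<Sum>i\<in>I. a i * w i)"
  shows "\<exists>w. (\<forall>i\<in>I. w i > 0) \<and>
    (\<forall>i\<in>I. (\<Sum>b\<in>Y. B b * (\<Prod>j\<in>I. w j powr l b j) * l b i) \<le> a i * w i)"
proof (cases "Y = {}")
  case True
  with a show ?thesis by (intro exI [of _ "\<lambda>_. 1"]) (auto simp: less_imp_le)
next
  case False
  then have I_ne: "I \<noteq> {}" using l1 by fastforce
  define H where "H w = (\<Sum>b\<in>Y. B b * (\<Prod>i\<in>I. w i powr l b i))" for w :: "'i \<Rightarrow> real"
  define K where "K = (\<Pi>\<^sub>E i\<in>UNIV. if i \<in> I then {0..1 / a i} else {0}) \<inter>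
    {w. (\<Sum>i\<in>I. a i * w i) = 1}"
  have H_pos: "H w > 0" if "\<And>i. i \<in> I \<Longrightarrow> w i > 0" for w
    unfolding H_def using that B False Y
    by (intro sum_pos mult_pos_pos prod_pos) (auto simp: less_imp_neq[symmetric])
  have K_iff: "w \<in> K \<longleftrightarrow> (\<forall>i\<in>I. w i \<ge> 0) \<and> (\<forall>i. i \<notin> I \<longrightarrow> w i = 0) \<and>
      (\<Sum>i\<in>I. a i * w i) = 1" for w
  proof -
    have "w i \<le> 1 / a i"
      if "\<forall>i\<in>I. w i \<ge> 0" "(\<Sum>i\<in>I. a i * w i) = 1" "i \<in> I" for i
    proof -
      have "a i * w i \<le> (\<Sum>i\<in>I. a i * w i)"
        using that a I by (intro member_le_sum) (auto intro: mult_nonneg_nonneg less_imp_le)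
      with that a [of i] show ?thesis by (simp add: field_simps)
    qed
    then show ?thesis by (auto simp: K_def PiE_iff split: if_splits)
  qed
  have "compactin (product_topology (\<lambda>_. euclidean) UNIV)
     (\<Pi>\<^sub>E i\<in>UNIV. if i \<in> I then {0..1 / a i} else {0})"
    by (subst compactin_PiE) auto
  moreover have "closed {w :: 'i \<Rightarrow> real. (\<Sum>i\<in>I. a i * w i) = 1}"
    by (intro closed_Collect_eq continuous_intros continuous_on_product_coordinates)
  ultimately have "compact K"
    unfolding K_def by (intro compact_Int_closed) (simp_all add: euclidean_product_topology)
  moreover have "continuous_on K H"
    unfolding H_def
    by (intro continuous_intros continuous_on_powr')
      (auto intro: continuous_on_subset [OF continuous_on_product_coordinates] simp: K_iff l)
  moreover
  have normalise: "(\<lambda>i. if i \<in> I then w i / (\<Sum>i\<in>I. a i * w i) else 0) \<in> K"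
    if "\<And>i. i \<in> I \<Longrightarrow> w i > 0" for w
  proof -
    have "(\<Sum>i\<in>I. a i * w i) > 0"
      using that a I I_ne by (intro sum_pos) auto
    with that show ?thesis
      by (auto simp: K_iff less_imp_le simp flip: sum_divide_distrib)
  qed
  have "K \<noteq> {}" using normalise [of "\<lambda>_. 1"] by auto
  ultimately obtain w where w: "w \<in> K" and max: "\<And>v. v \<in> K \<Longrightarrow> H v \<le> H w"
    using continuous_attains_sup [of K H] by auto
  \<comment> \<open>By homogeneity the maximality of \<open>w\<close> on \<open>K\<close> becomes an inequality without normalisation.\<close>
  have le_max: "H v \<le> H w * (\<Sum>i\<in>I. a i * v i)" if v: "\<And>i. i \<in> I \<Longrightarrow> v i > 0" for v
  proof -
    define s where "s = (\<Sum>i\<in>I. a i * v i)"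
    have s: "s > 0" unfolding s_def using v a I I_ne by (intro sum_pos) auto
    have prod_s: "(\<Prod>i\<in>I. (v i / s) powr l b i) = (\<Prod>i\<in>I. v i powr l b i) / s" if "b \<in> Y" for b
    proof -
      have "(\<Prod>i\<in>I. s powr l b i) = s"
        using l1 [OF that] s I_ne I by (simp flip: powr_sum)
      moreover have "(\<Prod>i\<in>I. (v i / s) powr l b i) = (\<Prod>i\<in>I. v i powr l b i / s powr l b i)"
        by (intro prod.cong refl powr_divide)
      ultimately show ?thesis by (simp add: prod_dividef)
    qed
    have "H v / s = H (\<lambda>i. if i \<in> I then v i / s else 0)"
      unfolding H_def sum_divide_distrib by (intro sum.cong refl) (simp add: prod_s cong: prod.cong)
    also have "\<dots> \<le> H w"
      unfolding s_def by (intro max normalise v)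
    finally show ?thesis using s by (simp add: s_def field_simps)
  qed
  have "H w > 0" using H_pos [of "\<lambda>_. 1"] le_max [of "\<lambda>_. 1"] a I I_ne
    by (smt (verit, best) mult_nonpos_nonneg sum_nonneg mult_1_right zero_less_one)
  have w_pos: "w i > 0" if "i \<in> I" for i
  proof (rule ccontr)
    assume "\<not> ?thesis"
    with w that have "w i = 0" unfolding K_iff by force
    with that I have "(\<Prod>j\<in>I. w j powr l b j) = 0" for b by (intro prod_zero) auto
    with \<open>H w > 0\<close> show False by (simp add: H_def)
  qed
  have w1: "(\<Sum>i\<in>I. a i * w i) = 1" using w by (simp add: K_iff)
  have "(\<Sum>b\<in>Y. B b * (\<Prod>j\<in>I. w j powr l b j) * l b i) \<le> a i * w i" if i: "i \<in> I" for i
  proof -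
    define P where "P b = (\<Prod>j\<in>I. w j powr l b j)" for b
    \<comment> \<open>Only the coordinate \<open>i\<close> is varied, by the factor \<open>exp t\<close>; then \<open>F\<close> has a minimum at \<open>0\<close>.\<close>
    define F where "F t = H w * (\<Sum>j\<in>I. a j * (w j * exp (of_bool (j = i) * t))) -
      (\<Sum>b\<in>Y. B b * P b * exp (l b i * t))" for t
    have "F t \<ge> 0" for t
    proof -
      have "(\<Prod>j\<in>I. (w j * exp (of_bool (j = i) * t)) powr l b j) = P b * exp (l b i * t)" for b
      proof -
        have "(\<Prod>j\<in>I. (w j * exp (of_bool (j = i) * t)) powr l b j) =
              (\<Prod>j\<in>I. w j powr l b j * (if j = i then exp (l b i * t) else 1))"
          using w_pos by (intro prod.cong refl)
            (auto simp: powr_mult less_imp_le exp_powr_real mult.commute)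
        then show ?thesis using i I by (simp add: prod.distrib P_def)
      qed
      then have "H (\<lambda>j. w j * exp (of_bool (j = i) * t)) = (\<Sum>b\<in>Y. B b * P b * exp (l b i * t))"
        by (simp add: H_def mult.assoc)
      then show ?thesis
        using le_max [of "\<lambda>j. w j * exp (of_bool (j = i) * t)"] w_pos by (simp add: F_def)
    qed
    moreover have "F 0 = 0" using w1 by (simp add: F_def H_def P_def)
    moreover have "(F has_real_derivative
        H w * (\<Sum>j\<in>I. a j * (w j * of_bool (j = i))) - (\<Sum>b\<in>Y. B b * P b * l b i)) (at 0)"
      unfolding F_def by (auto intro!: derivative_eq_intros simp: mult_ac)
    ultimately have "H w * (\<Sum>j\<in>I. a j * (w j * of_bool (j = i))) - (\<Sum>b\<in>Y. B b * P b * l b i) = 0"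
      by (intro DERIV_local_min [of F _ 0 1]) auto
    moreover have "(\<Sum>j\<in>I. a j * (w j * of_bool (j = i))) = a i * w i"
      using i I by (simp add: of_bool_def if_distrib cong: if_cong)
    moreover have "H w \<le> 1" using le [of w] w_pos w1 by (simp add: H_def)
    then have "H w * (a i * w i) \<le> a i * w i"
      using a [OF i] w_pos [OF i] by (intro mult_left_le_one_le) (auto simp: \<open>H w > 0\<close> less_imp_le)
    ultimately show ?thesis by (simp add: P_def)
  qed
  with w_pos show ?thesis by blast
qed

lemma affine_interpolation:
  fixes S :: "'a::euclidean_space set"
  assumes "\<not> affine_dependent S"
  shows "\<exists>y k. \<forall>x\<in>S. y \<bullet> x + k = h x"
proof (cases "S = {}")
  case False
  then obtain a where a: "a \<in> S" by blast
  have "independent ((\<lambda>x. - a + x) ` (S - {a}))"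
    using assms affine_dependent_iff_dependent2 [OF a] by blast
  then obtain g :: "'a \<Rightarrow> real" where g: "linear g"
    "\<forall>x\<in>(\<lambda>x. - a + x) ` (S - {a}). g x = h (a + x) - h a"
    using linear_independent_extend [of _ "\<lambda>x. h (a + x) - h a"] by blast
  have "h x = adjoint g 1 \<bullet> x + (h a - g a)" if "x \<in> S" for x
  proof -
    have "adjoint g 1 \<bullet> x = g x"
      using adjoint_works [OF g(1), of x 1] by (simp add: inner_commute)
    moreover have "g x = h x - h a + g a"
    proof (cases "x = a")
      case False
      with that g(2) have "g (- a + x) = h x - h a" by auto
      then show ?thesis using linear_diff [OF g(1), of x a] by simp
    qed simp
    ultimately show ?thesis by simp
  qed
  then show ?thesis by metis
qed auto

text \<open>
  On an affinely independent set every positive weight function has the form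
  \<open>exp (y \<bullet> x + k)\<close>, as its logarithm extends to an affine function.  The factor \<open>exp k\<close> cancels on
  both sides, so the critical weights are the values of the monomials at one point of the positive
  orthant, \<open>y\<close> being the vector of logarithms of its coordinates.
\<close>

lemma exponential_critical_point:
  fixes S :: "'a::euclidean_space set" and Y :: "'b set" and p :: "'b \<Rightarrow> 'a"
  assumes S: "finite S" "\<not> affine_dependent S" and Y: "finite Y"
    and a: "\<And>x. x \<in> S \<Longrightarrow> a x > 0" and B: "\<And>b. b \<in> Y \<Longrightarrow> B b > 0"
    and l: "\<And>b x. b \<in> Y \<Longrightarrow> x \<in> S \<Longrightarrow> l b x > 0" and l1: "\<And>b. b \<in> Y \<Longrightarrow> sum (l b) S = 1"
    and p: "\<And>b. b \<in> Y \<Longrightarrow> (\<Sum>x\<in>S. l b x *\<^sub>R x) = p b"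
    and le: "\<And>y. (\<Sum>b\<in>Y. B b * exp (y \<bullet> p b)) \<le> (\<Sum>x\<in>S. a x * exp (y \<bullet> x))"
  shows "\<exists>y. \<forall>x\<in>S. (\<Sum>b\<in>Y. B b * exp (y \<bullet> p b) * l b x) \<le> a x * exp (y \<bullet> x)"
proof -
  have coords: "\<exists>y k. (\<forall>x\<in>S. w x = exp (y \<bullet> x + k)) \<and>
      (\<forall>b\<in>Y. (\<Prod>x\<in>S. w x powr l b x) = exp (y \<bullet> p b + k))"
    if w: "\<And>x. x \<in> S \<Longrightarrow> w x > 0" for w
  proof -
    obtain y k where yk: "\<And>x. x \<in> S \<Longrightarrow> y \<bullet> x + k = ln (w x)"
      using affine_interpolation [OF S(2), of "\<lambda>x. ln (w x)"] by blast
    have w_eq: "w x = exp (y \<bullet> x + k)" if "x \<in> S" for x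
      using yk [OF that] w [OF that] by simp
    have "(\<Prod>x\<in>S. w x powr l b x) = exp (y \<bullet> p b + k)" if b: "b \<in> Y" for b
    proof -
      have "(\<Prod>x\<in>S. w x powr l b x) = (\<Prod>x\<in>S. exp (y \<bullet> (l b x *\<^sub>R x) + l b x * k))"
        by (intro prod.cong refl) (simp add: w_eq exp_powr_real algebra_simps)
      also have "\<dots> = exp (\<Sum>x\<in>S. y \<bullet> (l b x *\<^sub>R x) + l b x * k)"
        by (simp add: exp_sum S)
      also have "(\<Sum>x\<in>S. y \<bullet> (l b x *\<^sub>R x) + l b x * k) = y \<bullet> (\<Sum>x\<in>S. l b x *\<^sub>R x) + sum (l b) S * k"
        by (simp only: sum.distrib inner_sum_right sum_distrib_right)
      finally show ?thesis by (simp only: p [OF b] l1 [OF b] mult_1)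
    qed
    with w_eq show ?thesis by blast
  qed
  have scale: "(\<Sum>b\<in>Y. B b * exp (y \<bullet> p b + k) * r b) = exp k * (\<Sum>b\<in>Y. B b * exp (y \<bullet> p b) * r b)"
    for y r and k :: real by (simp add: exp_add sum_distrib_left mult_ac)
  have "\<exists>w. (\<forall>x\<in>S. w x > 0) \<and>
    (\<forall>x\<in>S. (\<Sum>b\<in>Y. B b * (\<Prod>j\<in>S. w j powr l b j) * l b x) \<le> a x * w x)"
  proof (rule critical_weights)
    fix w :: "'a \<Rightarrow> real" assume "\<And>x. x \<in> S \<Longrightarrow> w x > 0"
    then obtain y k where yk: "\<forall>x\<in>S. w x = exp (y \<bullet> x + k)"
      "\<forall>b\<in>Y. (\<Prod>x\<in>S. w x powr l b x) = exp (y \<bullet> p b + k)" using coords by metis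
    have "(\<Sum>b\<in>Y. B b * (\<Prod>x\<in>S. w x powr l b x)) = exp k * (\<Sum>b\<in>Y. B b * exp (y \<bullet> p b))"
      using yk(2) scale [of y k "\<lambda>_. 1"] by simp
    also have "\<dots> \<le> exp k * (\<Sum>x\<in>S. a x * exp (y \<bullet> x))" using le by simp
    also have "\<dots> = (\<Sum>x\<in>S. a x * w x)"
      using yk(1) by (simp add: exp_add sum_distrib_left mult_ac)
    finally show "(\<Sum>b\<in>Y. B b * (\<Prod>x\<in>S. w x powr l b x)) \<le> (\<Sum>x\<in>S. a x * w x)" .
  qed (use assms in auto)
  then obtain w where w: "\<And>x. x \<in> S \<Longrightarrow> w x > 0"
    "\<And>x. x \<in> S \<Longrightarrow> (\<Sum>b\<in>Y. B b * (\<Prod>j\<in>S. w j powr l b j) * l b x) \<le> a x * w x" by blast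
  obtain y k where yk: "\<forall>x\<in>S. w x = exp (y \<bullet> x + k)"
    "\<forall>b\<in>Y. (\<Prod>x\<in>S. w x powr l b x) = exp (y \<bullet> p b + k)" using coords w(1) by metis
  have "(\<Sum>b\<in>Y. B b * exp (y \<bullet> p b) * l b x) \<le> a x * exp (y \<bullet> x)" if x: "x \<in> S" for x
  proof -
    have "exp k * (\<Sum>b\<in>Y. B b * exp (y \<bullet> p b) * l b x) \<le> exp k * (a x * exp (y \<bullet> x))"
    proof -
      have "exp k * (\<Sum>b\<in>Y. B b * exp (y \<bullet> p b) * l b x) =
          (\<Sum>b\<in>Y. B b * (\<Prod>j\<in>S. w j powr l b j) * l b x)"
        unfolding scale [symmetric] using yk(2) by simp
      also have "\<dots> \<le> a x * w x" by (rule w(2) [OF x])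
      also have "\<dots> = exp k * (a x * exp (y \<bullet> x))" using yk(1) x by (simp add: exp_add)
      finally show ?thesis .
    qed
    then show ?thesis by simp
  qed
  then show ?thesis by blast
qed

section \<open>SONC polynomials on the positive orthant\<close>

text \<open>
  The value of \<open>p\<close> at the point with coordinates \<open>exp (y $ i)\<close>, except that each term with a non-even
  exponent is counted as if the signs of the coordinates made it negative.
\<close>

definition orthant_minorant :: "'n::finite mpolynomial \<Rightarrow> real ^ 'n \<Rightarrow> real" where
  "orthant_minorant p y = (\<Sum>e\<in>Poly_Mapping.keys p.
    (if int_point e \<in> even_lattice then Poly_Mapping.lookup p e
     else - \<bar>Poly_Mapping.lookup p e\<bar>) * exp (y \<bullet> rvec e))"

lemma prod_exp_power: "(\<Prod>i\<in>UNIV. exp (y $ i) ^ (e $ i)) = exp (y \<bullet> rvec e)"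
  for y :: "real ^ 'n::finite"
  by (simp add: inner_vec_def exp_sum rvec_nth mult.commute flip: exp_of_nat_mult)

text \<open>
  With a single non-even exponent \<open>b\<close>, the pessimistic value is attained: changing the sign of one
  coordinate in which \<open>b\<close> is odd changes the sign of that term and of no other.
\<close>

lemma orthant_minorant_nonneg:
  fixes p :: "'n::finite mpolynomial"
  assumes p: "nonnegative p"
    and even: "\<And>e. e \<in> Poly_Mapping.keys p \<Longrightarrow> e \<noteq> b \<Longrightarrow> int_point e \<in> even_lattice"
  shows "orthant_minorant p y \<ge> 0"
proof (cases "int_point b \<in> even_lattice \<or> Poly_Mapping.lookup p b \<le> 0")
  case True
  have "orthant_minorant p y = evaluate p (\<chi> i. exp (y $ i))"
    unfolding orthant_minorant_def evaluate_def
  proof (intro sum.cong refl)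
    fix e assume e: "e \<in> Poly_Mapping.keys p"
    have "int_point e \<in> even_lattice \<or> Poly_Mapping.lookup p e \<le> 0"
      using True even [OF e] by blast
    then show "(if int_point e \<in> even_lattice then Poly_Mapping.lookup p e
         else - \<bar>Poly_Mapping.lookup p e\<bar>) * exp (y \<bullet> rvec e) =
        Poly_Mapping.lookup p e * (\<Prod>i\<in>UNIV. (\<chi> i. exp (y $ i)) $ i ^ e $ i)"
      by (auto simp: prod_exp_power)
  qed
  with p show ?thesis by (simp add: nonnegative_def)
next
  case False
  then obtain j where j: "odd (b $ j)"
    by (auto simp: even_lattice_def int_point_def)
  define x where "x = (\<chi> i. (if i = j then - 1 else 1) * exp (y $ i))"
  have x: "(\<Prod>i\<in>UNIV. (x $ i) ^ (e $ i)) = (- 1) ^ (e $ j) * exp (y \<bullet> rvec e)" for e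
  proof -
    have "(\<Prod>i\<in>UNIV. (x $ i) ^ (e $ i)) =
        (\<Prod>i\<in>UNIV. (if i = j then (- 1) ^ (e $ j) else 1) * exp (y $ i) ^ (e $ i))"
      by (intro prod.cong refl) (simp add: x_def power_minus')
    then show ?thesis by (simp add: prod.distrib prod_exp_power)
  qed
  have "orthant_minorant p y = evaluate p x"
    unfolding orthant_minorant_def evaluate_def
  proof (intro sum.cong refl)
    fix e assume e: "e \<in> Poly_Mapping.keys p"
    show "(if int_point e \<in> even_lattice then Poly_Mapping.lookup p e
         else - \<bar>Poly_Mapping.lookup p e\<bar>) * exp (y \<bullet> rvec e) =
        Poly_Mapping.lookup p e * (\<Prod>i\<in>UNIV. x $ i ^ e $ i)"
    proof (cases "int_point e \<in> even_lattice")
      case True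
      then have "even (e $ j)" by (simp add: even_lattice_def int_point_def)
      with True show ?thesis by (simp add: x)
    next
      case odd: False
      with even [OF e] have "e = b" by blast
      with False j odd show ?thesis by (simp add: x)
    qed
  qed
  with p show ?thesis by (simp add: nonnegative_def)
qed

lemma orthant_minorant_superset:
  assumes "finite A" "Poly_Mapping.keys p \<subseteq> A"
  shows "orthant_minorant p y = (\<Sum>e\<in>A.
    (if int_point e \<in> even_lattice then Poly_Mapping.lookup p e
     else - \<bar>Poly_Mapping.lookup p e\<bar>) * exp (y \<bullet> rvec e))"
  unfolding orthant_minorant_def using assms
  by (intro sum.mono_neutral_left) (auto simp: in_keys_iff)

text \<open>
  Even terms add up exactly, and for the others this is the triangle inequality.
  Nonnegativity therefore passes from the summands to the sum, even when terms cancel.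
\<close>

lemma orthant_minorant_add:
  "orthant_minorant p y + orthant_minorant q y \<le> orthant_minorant (p + q) y"
proof -
  let ?A = "Poly_Mapping.keys p \<union> Poly_Mapping.keys q"
  have "orthant_minorant r y = (\<Sum>e\<in>?A. (if int_point e \<in> even_lattice then Poly_Mapping.lookup r e
     else - \<bar>Poly_Mapping.lookup r e\<bar>) * exp (y \<bullet> rvec e))" if "r \<in> {p, q, p + q}" for r
    using that Poly_Mapping.keys_add [of p q] by (intro orthant_minorant_superset) auto
  then show ?thesis
    by (auto simp: lookup_add simp flip: sum.distrib distrib_right intro!: sum_mono mult_right_mono)
qed

lemma circuit_polynomial_one_odd_exponent:
  assumes "circuit_polynomial p"
  shows "\<exists>b. \<forall>e\<in>Poly_Mapping.keys p. e \<noteq> b \<longrightarrow> int_point e \<in> even_lattice"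
proof -
  from assms obtain r :: nat and g c b d where
    p: "p = Poly_Mapping.single b d + (\<Sum>j\<le>r. Poly_Mapping.single (g j) (c j))"
    and g: "\<forall>j\<le>r. int_point (g j) \<in> even_lattice"
    unfolding circuit_polynomial_def by blast
  have "Poly_Mapping.keys p \<subseteq> {b} \<union> (\<Union>j\<le>r. {g j})"
    unfolding p
    by (intro order_trans [OF Poly_Mapping.keys_add] Un_mono
        order_trans [OF Poly_Mapping.keys_sum] UN_mono) auto
  with g show ?thesis by blast
qed

lemma SONC_orthant_minorant_nonneg:
  assumes "SONC p"
  shows "orthant_minorant p y \<ge> 0"
proof -
  from assms obtain ps where ps: "\<forall>q\<in>set ps. circuit_polynomial q \<and> nonnegative q"
    and p: "p = sum_list ps" by (auto simp: SONC_def)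
  have "orthant_minorant q y \<ge> 0" if "q \<in> set ps" for q
  proof -
    from ps that obtain b where "\<And>e. e \<in> Poly_Mapping.keys q \<Longrightarrow> e \<noteq> b \<Longrightarrow> int_point e \<in> even_lattice"
      using circuit_polynomial_one_odd_exponent by blast
    with ps that show ?thesis using orthant_minorant_nonneg by blast
  qed
  then have "orthant_minorant (sum_list ps) y \<ge> 0"
  proof (induction ps)
    case Nil
    then show ?case by (simp add: orthant_minorant_def)
  next
    case (Cons q qs)
    then have "0 \<le> orthant_minorant q y + orthant_minorant (sum_list qs) y" by simp
    also have "\<dots> \<le> orthant_minorant (q + sum_list qs) y" by (rule orthant_minorant_add)
    finally show ?case by simp
  qed
  then show ?thesis by (simp add: p)
qed

section \<open>Binomial squares along a mediated set\<close>

text \<open>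
  Inside the convex hull of \<open>D\<close> all coordinates are nonnegative, so the maximal mediated set can be
  described with exponent vectors.  Its even points are the doubles \<open>u + u\<close>, and the midpoint of
  \<open>u + u\<close> and \<open>v + v\<close> is \<open>u + v\<close>.
\<close>

lemma maximal_mediated_halves:
  fixes D :: "(nat ^ 'n) set"
  assumes D: "finite D"
  defines "N \<equiv> {e. int_point e \<in> maximal_mediated (int_point ` D)}"
  shows "finite N" "D \<subseteq> N"
    and "\<And>e. e \<in> N - D \<Longrightarrow> \<exists>u v. u + u \<in> N \<and> v + v \<in> N \<and> u \<noteq> v \<and> e = u + v"
proof -
  define M where "M = maximal_mediated (int_point ` D)"
  have M: "mediated (int_point ` D) M"
    unfolding M_def using D by (intro mediated_maximal_mediated) auto
  have N: "N = int_point -` M" by (auto simp: N_def M_def)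
  show "finite N"
    unfolding N using M by (intro finite_vimageI inj_int_point) (auto simp: mediated_def)
  show "D \<subseteq> N" using M by (auto simp: N mediated_def)
  have "real_point ` M \<subseteq> convex hull (rvec ` D)"
    using mediated_subset_convex_hull [OF M] by (simp add: image_image)
  also have "\<dots> \<subseteq> {x. \<forall>i. x $ i \<ge> 0}"
    by (intro hull_minimal) (auto simp: rvec_nth convex_def)
  finally have nonneg: "z $ i \<ge> 0" if "z \<in> M" for z i
    using that by (auto simp: real_point_def)
  have double: "\<exists>u. z = int_point (u + u)" if "z \<in> M" "z \<in> even_lattice" for z
  proof -
    have "z = int_point (\<chi> i. nat (z $ i))"
      using nonneg [OF that(1)] by (simp add: int_point_def)
    with that(2) show ?thesis using int_point_even_iff by metis
  qed
  fix e assume e: "e \<in> N - D"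
  then have "int_point e \<notin> int_point ` D"
    using inj_image_mem_iff [OF inj_int_point] by auto
  with e M have "int_point e \<in> Mid M" by (auto simp: N mediated_def)
  then obtain s t where st: "s \<in> M" "s \<in> even_lattice" "t \<in> M" "t \<in> even_lattice" "s \<noteq> t"
    and e_eq: "int_point e = (\<chi> i. (s $ i + t $ i) div 2)" by (auto simp: Mid_def)
  obtain u v where uv: "s = int_point (u + u)" "t = int_point (v + v)"
    using double st by metis
  have "int_point e = int_point (u + v)"
    unfolding e_eq uv by (simp add: int_point_def vec_eq_iff)
  then have "e = u + v" by (rule injD [OF inj_int_point])
  with st uv show "\<exists>u v. u + u \<in> N \<and> v + v \<in> N \<and> u \<noteq> v \<and> e = u + v"
    by (auto simp: N)
qed

text \<open>
  The multiplicative function \<open>c\<close> rescales the variables: it replaces the monomial \<open>x\<^sup>e\<close> by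
  \<open>c e\<close> times \<open>x\<^sup>e\<close>, which is \<open>x\<^sup>e\<close> at a rescaled point.  This allows arbitrary
  equality points in the inequalities below without substitution into polynomials.
\<close>

locale halving =
  fixes N D :: "(nat ^ 'n::finite) set" and c :: "nat ^ 'n \<Rightarrow> real"
  assumes finite_N: "finite N" and D_subset: "D \<subseteq> N"
    and halves: "\<And>e. e \<in> N - D \<Longrightarrow> \<exists>u v. u + u \<in> N \<and> v + v \<in> N \<and> u \<noteq> v \<and> e = u + v"
    and c_add: "\<And>u v. c (u + v) = c u * c v"
begin

definition sos_coeffs :: "(nat ^ 'n \<Rightarrow> real) \<Rightarrow> bool" where
  "sos_coeffs v \<longleftrightarrow> sum_of_squares (\<Sum>e\<in>N. Poly_Mapping.single e (v e * c e))"

lemma sos_coeffs_add: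
  assumes "sos_coeffs v" "sos_coeffs v'" "r \<ge> 0"
  shows "sos_coeffs (\<lambda>e. v e + r * v' e)"
proof -
  have "(\<Sum>e\<in>N. Poly_Mapping.single e ((v e + r * v' e) * c e)) =
    (\<Sum>e\<in>N. Poly_Mapping.single e (v e * c e)) +
    Poly_Mapping.single 0 r * (\<Sum>e\<in>N. Poly_Mapping.single e (v' e * c e))"
    by (simp add: sum_distrib_left mult_single sum.distrib single_add distrib_right mult.assoc)
  then show ?thesis
    using assms unfolding sos_coeffs_def by (simp add: sum_of_squares_add sum_of_squares_scale)
qed

text \<open>
  This is half of the square of \<open>x\<^sup>u + s x\<^sup>v\<close>, in the rescaled variables.
\<close>

lemma sos_coeffs_binomial:
  assumes "u + u \<in> N" "v + v \<in> N" "u + v \<in> N" and s: "s\<^sup>2 = 1"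
  shows "sos_coeffs (\<lambda>e. of_bool (e = u + u) / 2 + of_bool (e = v + v) / 2 + s * of_bool (e = u + v))"
    (is "sos_coeffs ?w")
proof -
  have delta: "(\<Sum>e\<in>N. Poly_Mapping.single e (r * of_bool (e = d) * c e)) = Poly_Mapping.single d (r * c d)"
    if "d \<in> N" for d r
  proof -
    have "(\<Sum>e\<in>N. Poly_Mapping.single e (r * of_bool (e = d) * c e)) =
        (\<Sum>e\<in>N. if e = d then Poly_Mapping.single d (r * c d) else 0)"
      by (intro sum.cong) auto
    with that finite_N show ?thesis by simp
  qed
  have "(\<Sum>e\<in>N. Poly_Mapping.single e (?w e * c e)) =
      (\<Sum>e\<in>N. Poly_Mapping.single e (1/2 * of_bool (e = u + u) * c e)) +
      (\<Sum>e\<in>N. Poly_Mapping.single e (1/2 * of_bool (e = v + v) * c e)) +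
      (\<Sum>e\<in>N. Poly_Mapping.single e (s * of_bool (e = u + v) * c e))"
    by (simp only: flip: sum.distrib single_add) (simp add: distrib_right)
  also have "\<dots> = Poly_Mapping.single (u + u) (1/2 * c (u + u)) +
      Poly_Mapping.single (v + v) (1/2 * c (v + v)) + Poly_Mapping.single (u + v) (s * c (u + v))"
    using assms by (simp only: delta)
  also have "\<dots> = Poly_Mapping.single 0 (1/2) *
      (Poly_Mapping.single u (c u) + Poly_Mapping.single v (s * c v)) ^ 2"
  proof -
    let ?h = "Poly_Mapping.single 0 (1/2) :: 'n mpolynomial"
      and ?p = "Poly_Mapping.single u (c u)" and ?q = "Poly_Mapping.single v (s * c v)"
    have h: "?h + ?h = 1" by (simp flip: single_add)
    have "s * c v * (s * c v) = s\<^sup>2 * (c v * c v)" by (simp only: power2_eq_square mult_ac)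
    then have q: "s * c v * (s * c v) = c v * c v" by (simp only: s mult_1)
    have "?h * (?p + ?q)\<^sup>2 = ?h * (?p * ?p) + ?h * (?q * ?q) + (?h + ?h) * (?p * ?q)"
      by (simp only: power2_eq_square algebra_simps)
    also have "\<dots> = ?h * (?p * ?p) + ?h * (?q * ?q) + ?p * ?q"
      by (simp only: h mult_1)
    also have "\<dots> = Poly_Mapping.single (u + u) (1/2 * (c u * c u)) +
        Poly_Mapping.single (v + v) (1/2 * (c v * c v)) + Poly_Mapping.single (u + v) (c u * (s * c v))"
      by (simp only: mult_single add_0 q)
    also have "c u * (s * c v) = s * (c u * c v)" by (rule mult.left_commute)
    finally show ?thesis by (simp only: c_add)
  qed
  finally show ?thesis
    unfolding sos_coeffs_def by (simp add: sum_of_squares_scale sum_of_squares_square)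
qed

definition barycentric :: "nat ^ 'n \<Rightarrow> (nat ^ 'n \<Rightarrow> real) \<Rightarrow> bool" where
  "barycentric d w \<longleftrightarrow> (\<forall>e\<in>N. w e \<ge> 0) \<and> sum w N = 1 \<and> (\<Sum>e\<in>N. w e *\<^sub>R rvec e) = rvec d"

text \<open>
  A weighted inequality of arithmetic and geometric means for the monomial at \<open>d\<close>, certified by a sum
  of squares.
\<close>

definition dominates :: "(nat ^ 'n \<Rightarrow> real) \<Rightarrow> nat ^ 'n \<Rightarrow> bool" where
  "dominates w d \<longleftrightarrow> barycentric d w \<and> sos_coeffs (\<lambda>e. w e - of_bool (e = d))"

text \<open>
  A weight of \<open>1\<close> at \<open>z\<close> leaves nothing for the other points, and the barycentre would be \<open>z\<close>.
\<close>

lemma barycentric_less_1: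
  assumes "barycentric d w" "z \<in> N" "z \<noteq> d"
  shows "w z < 1"
proof (rule ccontr)
  assume z: "\<not> w z < 1"
  have "sum w N = w z + sum w (N - {z})" using finite_N assms(2) by (rule sum.remove)
  moreover have "sum w (N - {z}) \<ge> 0"
    using assms by (intro sum_nonneg) (auto simp: barycentric_def)
  ultimately have 1: "w z = 1" "sum w (N - {z}) = 0"
    using z assms(1) by (auto simp: barycentric_def)
  then have "w e = 0" if "e \<in> N - {z}" for e
    using assms(1) finite_N that sum_nonneg_eq_0_iff [of "N - {z}" w] by (auto simp: barycentric_def)
  then have "(\<Sum>e\<in>N. w e *\<^sub>R rvec e) = rvec z"
    using 1 finite_N assms(2) by (simp add: sum.remove)
  with assms show False
    using inj_rvec by (auto simp: barycentric_def dest: injD)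
qed

lemma barycentric_midpoint:
  assumes "barycentric (u + u) w" "barycentric (v + v) w'"
  shows "barycentric (u + v) (\<lambda>e. (w e + w' e) / 2)"
proof -
  have "(\<Sum>e\<in>N. ((w e + w' e) / 2) *\<^sub>R rvec e) =
      (1 / 2) *\<^sub>R ((\<Sum>e\<in>N. w e *\<^sub>R rvec e) + (\<Sum>e\<in>N. w' e *\<^sub>R rvec e))"
    by (simp add: scaleR_sum_right scaleR_add_left scaleR_add_right add_divide_distrib flip: sum.distrib)
  also have "\<dots> = rvec (u + v)"
    using assms by (simp add: barycentric_def rvec_add vec_eq_iff)
  finally show ?thesis
    using assms by (simp add: barycentric_def sum.distrib flip: sum_divide_distrib)
qed

lemma sos_coeffs_midpoint:
  assumes "dominates w (u + u)" "dominates w' (v + v)"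
    and "u + u \<in> N" "v + v \<in> N" "u + v \<in> N" "s\<^sup>2 = 1"
  shows "sos_coeffs (\<lambda>e. (w e + w' e) / 2 + s * of_bool (e = u + v))"
proof -
  have "sos_coeffs (\<lambda>e. (of_bool (e = u + u) / 2 + of_bool (e = v + v) / 2 + s * of_bool (e = u + v))
      + 1/2 * (w e - of_bool (e = u + u)) + 1/2 * (w' e - of_bool (e = v + v)))"
    using assms by (intro sos_coeffs_add sos_coeffs_binomial) (auto simp: dominates_def)
  also have "(\<lambda>e. (of_bool (e = u + u) / 2 + of_bool (e = v + v) / 2 + s * of_bool (e = u + v))
      + 1/2 * (w e - of_bool (e = u + u)) + 1/2 * (w' e - of_bool (e = v + v))) =
    (\<lambda>e. (w e + w' e) / 2 + s * of_bool (e = u + v))"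
    by (simp add: fun_eq_iff field_simps)
  finally show ?thesis .
qed

text \<open>
  Eliminates the monomial at \<open>z\<close>: a multiple of the certificate for \<open>z\<close> is added to the one for \<open>d\<close>.
  The certificate for \<open>z\<close> may itself use the monomial at \<open>z\<close>, with a weight below \<open>1\<close>; the
  denominator accounts for that, and the new weight at \<open>z\<close> is \<open>0\<close>.
\<close>

lemma dominates_substitute:
  assumes w: "dominates w d" and x: "dominates x z" and z: "z \<in> N" "x z < 1"
  shows "dominates (\<lambda>e. w e + w z / (1 - x z) * (x e - of_bool (e = z))) d"
proof -
  define r where "r = w z / (1 - x z)"
  have "w z \<ge> 0" using w z(1) by (simp add: dominates_def barycentric_def)
  then have r: "r \<ge> 0" "r * (1 - x z) = w z"
    using z(2) by (simp_all add: r_def)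
  have "(\<Sum>e\<in>N. x e - of_bool (e = z)) = 0"
    using x z finite_N by (simp add: dominates_def barycentric_def sum_subtractf of_bool_def)
  then have s1: "(\<Sum>e\<in>N. w e + r * (x e - of_bool (e = z))) = 1"
    using w by (simp add: dominates_def barycentric_def sum.distrib flip: sum_distrib_left)
  have "(\<Sum>e\<in>N. (x e - of_bool (e = z)) *\<^sub>R rvec e) = (\<Sum>e\<in>N. x e *\<^sub>R rvec e) - rvec z"
    using z finite_N
    by (simp add: scaleR_diff_left sum_subtractf of_bool_def if_distrib [of "\<lambda>t. t *\<^sub>R _"] cong: if_cong)
  then have "(\<Sum>e\<in>N. (x e - of_bool (e = z)) *\<^sub>R rvec e) = 0"
    using x by (simp add: dominates_def barycentric_def)
  moreover have "(\<Sum>e\<in>N. (w e + r * (x e - of_bool (e = z))) *\<^sub>R rvec e) =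
    (\<Sum>e\<in>N. w e *\<^sub>R rvec e) + r *\<^sub>R (\<Sum>e\<in>N. (x e - of_bool (e = z)) *\<^sub>R rvec e)"
    by (simp add: scaleR_sum_right scaleR_add_left flip: sum.distrib)
  ultimately have s2: "(\<Sum>e\<in>N. (w e + r * (x e - of_bool (e = z))) *\<^sub>R rvec e) = rvec d"
    using w by (simp add: dominates_def barycentric_def)
  have nonneg: "w e + r * (x e - of_bool (e = z)) \<ge> 0" if "e \<in> N" for e
  proof (cases "e = z")
    case True
    then show ?thesis using r(2) by (simp add: algebra_simps)
  next
    case False
    then show ?thesis using r(1) w x that by (simp add: dominates_def barycentric_def)
  qed
  have "sos_coeffs (\<lambda>e. (w e - of_bool (e = d)) + r * (x e - of_bool (e = z)))"
    using w x r by (intro sos_coeffs_add) (auto simp: dominates_def)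
  also have "(\<lambda>e. (w e - of_bool (e = d)) + r * (x e - of_bool (e = z))) =
      (\<lambda>e. w e + r * (x e - of_bool (e = z)) - of_bool (e = d))" by auto
  finally show ?thesis
    unfolding dominates_def barycentric_def r_def [symmetric] using s1 s2 nonneg by auto
qed

text \<open>
  The points of \<open>F\<close> are eliminated one at a time.  To remove \<open>z = u + v\<close>, average the
  certificates for \<open>u + u\<close> and \<open>v + v\<close> and add half of a binomial square: this bounds the monomial at \<open>z\<close>.
  As \<open>u + u\<close> and \<open>v + v\<close> differ from \<open>z\<close>, the weight at \<open>z\<close> is below \<open>1\<close>, and the bound can be
  substituted into every other certificate.  Since this is done by solving one linear
  equation at a time, circular dependencies among the points do no harm.
\<close>

lemma dominates_avoiding:
  assumes "F \<subseteq> N - D" "d \<in> N"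
  shows "\<exists>w. dominates w d \<and> (\<forall>e\<in>F. w e = 0)"
proof -
  have "finite F" using finite_subset [OF assms(1)] finite_N by simp
  then show ?thesis using assms
  proof (induction F arbitrary: d rule: finite_induct)
    case empty
    have "sos_coeffs (\<lambda>e. 0)"
      by (simp add: sos_coeffs_def sum_of_squares_zero)
    then have "dominates (\<lambda>e. of_bool (e = d)) d"
      using empty finite_N
      by (simp add: dominates_def barycentric_def of_bool_def if_distrib [of "\<lambda>t. t *\<^sub>R _"] cong: if_cong)
    then show ?case by blast
  next
    case (insert z F)
    then have z: "z \<in> N - D" and F: "F \<subseteq> N - D" by auto
    obtain u v where uv: "u + u \<in> N" "v + v \<in> N" "u \<noteq> v" and z_eq: "z = u + v"
      using halves [OF z] by blast
    obtain wu wv where wu: "dominates wu (u + u)" "\<forall>e\<in>F. wu e = 0"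
      and wv: "dominates wv (v + v)" "\<forall>e\<in>F. wv e = 0"
      using insert.IH [OF F uv(1)] insert.IH [OF F uv(2)] by blast
    define x where "x = (\<lambda>e. (wu e + wv e) / 2)"
    have x: "dominates x z"
      unfolding x_def z_eq dominates_def
      using sos_coeffs_midpoint [OF wu(1) wv(1), of "- 1"] uv z wu(1) wv(1)
      by (auto simp: z_eq dominates_def intro: barycentric_midpoint)
    have "wu z < 1" "wv z < 1"
      using wu(1) wv(1) z uv(3) z_eq
      by (auto intro!: barycentric_less_1 simp: dominates_def)
    then have xz: "x z < 1" by (simp add: x_def)
    obtain w where w: "dominates w d" "\<forall>e\<in>F. w e = 0"
      using insert.IH [OF F] insert.prems by blast
    let ?w = "\<lambda>e. w e + w z / (1 - x z) * (x e - of_bool (e = z))"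
    have "?w e = 0" if "e \<in> insert z F" for e
      using that insert.hyps(2) w(2) wu(2) wv(2) xz by (auto simp: x_def field_simps)
    then show ?case
      using dominates_substitute [OF w(1) x _ xz] z by blast
  qed
qed

text \<open>
  After the elimination of all of \<open>N - D\<close>, the last binomial square may be taken with either sign, which
  gives both signs of the monomial at \<open>d\<close>, also when \<open>d\<close> is even.
\<close>

theorem halving_sum_of_squares:
  assumes d: "d \<in> N - D" and s: "s\<^sup>2 = 1"
  shows "\<exists>w. (\<Sum>e\<in>D. w e *\<^sub>R rvec e) = rvec d \<and> sum w D = 1 \<and>
    sum_of_squares ((\<Sum>e\<in>D. Poly_Mapping.single e (w e * c e)) + Poly_Mapping.single d (s * c d))"
proof -
  obtain u v where uv: "u + u \<in> N" "v + v \<in> N" and d_eq: "d = u + v"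
    using halves [OF d] by blast
  obtain wu wv where wu: "dominates wu (u + u)" "\<forall>e\<in>N - D. wu e = 0"
    and wv: "dominates wv (v + v)" "\<forall>e\<in>N - D. wv e = 0"
    using dominates_avoiding [OF order_refl uv(1)] dominates_avoiding [OF order_refl uv(2)] by blast
  define w where "w = (\<lambda>e. (wu e + wv e) / 2)"
  have w0: "w e = 0" if "e \<in> N - D" for e
    using that wu(2) wv(2) by (simp add: w_def)
  have bary: "barycentric d w"
    unfolding w_def d_eq using wu wv by (intro barycentric_midpoint) (auto simp: dominates_def)
  have "sos_coeffs (\<lambda>e. w e + s * of_bool (e = d))"
    unfolding w_def d_eq using wu wv uv d d_eq s by (intro sos_coeffs_midpoint) auto
  moreover have "(\<Sum>e\<in>N. Poly_Mapping.single e ((w e + s * of_bool (e = d)) * c e)) =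
      (\<Sum>e\<in>N. Poly_Mapping.single e (w e * c e)) +
      (\<Sum>e\<in>N. if e = d then Poly_Mapping.single d (s * c d) else 0)"
    by (simp only: distrib_right single_add sum.distrib) (auto intro!: sum.cong)
  moreover have "(\<Sum>e\<in>N. Poly_Mapping.single e (w e * c e)) = (\<Sum>e\<in>D. Poly_Mapping.single e (w e * c e))"
    "sum w N = sum w D" "(\<Sum>e\<in>N. w e *\<^sub>R rvec e) = (\<Sum>e\<in>D. w e *\<^sub>R rvec e)"
    using w0 D_subset finite_N by (auto intro!: sum.mono_neutral_right)
  ultimately show ?thesis
    using bary d finite_N by (auto simp: sos_coeffs_def barycentric_def)
qed

end

section \<open>Decomposition into circuits and the characterisation\<close>

lemma affine_independent_weights_unique:
  fixes S :: "'a::real_vector set"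
  assumes "finite S" "\<not> affine_dependent S"
    and "sum u S = sum v S" "(\<Sum>x\<in>S. u x *\<^sub>R x) = (\<Sum>x\<in>S. v x *\<^sub>R x)" "x \<in> S"
  shows "u x = v x"
proof (rule ccontr)
  assume "u x \<noteq> v x"
  then have "\<exists>x\<in>S. u x - v x \<noteq> 0" using assms(5) by auto
  moreover have "(\<Sum>x\<in>S. u x - v x) = 0" "(\<Sum>x\<in>S. (u x - v x) *\<^sub>R x) = 0"
    using assms(3,4) by (simp_all add: sum_subtractf scaleR_diff_left)
  ultimately have "affine_dependent S"
    unfolding affine_dependent_explicit_finite [OF assms(1)]
    by (intro exI [of _ "\<lambda>x. u x - v x"]) blast
  with assms(2) show False ..
qed

text \<open>
  At the critical point given by \<open>y\<close>, the quantity \<open>r b e\<close> is the share of the vertex coefficient at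
  \<open>e\<close> that suffices to balance the term at \<open>b\<close>.  So \<open>f\<close> is the sum over \<open>b \<in> Y\<close> of circuit polynomials
  with vertices in \<open>D\<close>, plus nonnegative multiples of even monomials.  Each of
  these circuit polynomials is, in variables rescaled by \<open>c\<close>, a multiple of a weighted
  arithmetic mean of vertex monomials plus or minus their geometric mean.
\<close>

theorem SONC_mediated_sum_of_squares:
  fixes f :: "'n::finite mpolynomial" and D Y :: "(nat ^ 'n) set"
  assumes D: "finite D" "int_point ` D \<subseteq> even_lattice" "\<not> affine_dependent (rvec ` D)"
    and Y: "finite Y" "rvec ` Y \<subseteq> interior (convex hull (rvec ` D))" "Y \<inter> D = {}"
    and keys: "Poly_Mapping.keys f = D \<union> Y"
    and pos: "\<And>e. e \<in> D \<Longrightarrow> Poly_Mapping.lookup f e > 0"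
    and sgn: "\<And>e. e \<in> Y \<Longrightarrow> Poly_Mapping.lookup f e < 0 \<or> int_point e \<notin> even_lattice"
    and SONC: "SONC f"
    and med: "int_point ` Y \<subseteq> maximal_mediated (int_point ` D)"
  shows "sum_of_squares f"
proof -
  let ?a = "Poly_Mapping.lookup f"
  have inj_D: "inj_on rvec D" using inj_rvec by (rule inj_on_subset) simp
  have "\<forall>b\<in>Y. \<exists>l. (\<forall>x\<in>rvec ` D. l x > 0) \<and> sum l (rvec ` D) = 1 \<and>
      (\<Sum>x\<in>rvec ` D. l x *\<^sub>R x) = rvec b"
  proof
    fix b assume "b \<in> Y"
    with Y(2) have "rvec b \<in> interior (convex hull (rvec ` D))" by auto
    then show "\<exists>l. (\<forall>x\<in>rvec ` D. l x > 0) \<and> sum l (rvec ` D) = 1 \<and>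
      (\<Sum>x\<in>rvec ` D. l x *\<^sub>R x) = rvec b"
      unfolding interior_convex_hull_explicit_minimal [OF D(3)] by (auto split: if_splits)
  qed
  from bchoice [OF this] obtain l where l: "\<And>b x. b \<in> Y \<Longrightarrow> x \<in> rvec ` D \<Longrightarrow> l b x > 0"
    "\<And>b. b \<in> Y \<Longrightarrow> sum (l b) (rvec ` D) = 1"
    "\<And>b. b \<in> Y \<Longrightarrow> (\<Sum>x\<in>rvec ` D. l b x *\<^sub>R x) = rvec b"
    by blast
  have minorant: "(\<Sum>b\<in>Y. \<bar>?a b\<bar> * exp (y \<bullet> rvec b)) \<le> (\<Sum>e\<in>D. ?a e * exp (y \<bullet> rvec e))" for y
  proof -
    have "orthant_minorant f y = (\<Sum>e\<in>D. ?a e * exp (y \<bullet> rvec e)) + (\<Sum>b\<in>Y. - \<bar>?a b\<bar> * exp (y \<bullet> rvec b))"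
      unfolding orthant_minorant_def keys using D(1,2) Y(1,3)
      by (subst sum.union_disjoint) (auto intro!: arg_cong2 [where f = "(+)"] sum.cong dest: pos dest!: sgn)
    with SONC_orthant_minorant_nonneg [OF SONC, of y] show ?thesis
      by (simp add: sum_negf)
  qed
  have "\<exists>y. \<forall>x\<in>rvec ` D. (\<Sum>b\<in>Y. \<bar>?a b\<bar> * exp (y \<bullet> rvec b) * l b x) \<le> ?a (inv rvec x) * exp (y \<bullet> x)"
  proof (rule exponential_critical_point)
    show "(\<Sum>b\<in>Y. \<bar>?a b\<bar> * exp (y \<bullet> rvec b)) \<le> (\<Sum>x\<in>rvec ` D. ?a (inv rvec x) * exp (y \<bullet> x))" for y
      using minorant [of y] by (simp add: sum.reindex [OF inj_D] inv_f_f [OF inj_rvec])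
    show "0 < \<bar>?a b\<bar>" if "b \<in> Y" for b
      using that keys by (auto simp: in_keys_iff)
  qed (use D Y l pos in \<open>auto simp: inv_f_f [OF inj_rvec]\<close>)
  then obtain y where y:
    "\<And>e. e \<in> D \<Longrightarrow> (\<Sum>b\<in>Y. \<bar>?a b\<bar> * exp (y \<bullet> rvec b) * l b (rvec e)) \<le> ?a e * exp (y \<bullet> rvec e)"
    by (auto simp: inv_f_f [OF inj_rvec])
  define c where "c e = exp (- (y \<bullet> rvec e))" for e
  define N where "N = {e. int_point e \<in> maximal_mediated (int_point ` D)}"
  interpret halving N D c
  proof
    show "c (u + v) = c u * c v" for u v
      by (simp add: c_def rvec_add inner_add_right flip: exp_add)
  qed (use maximal_mediated_halves [OF D(1)] in \<open>auto simp: N_def\<close>)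
  define r where "r b e = \<bar>?a b\<bar> / c b * (l b (rvec e) * c e)" for b e
  have "sum_of_squares ((\<Sum>e\<in>D. Poly_Mapping.single e (r b e)) + Poly_Mapping.single b (?a b))"
    if b: "b \<in> Y" for b
  proof -
    have "b \<in> N - D" using b Y(3) med by (auto simp: N_def)
    moreover have a_b: "?a b \<noteq> 0" using b keys by (auto simp: in_keys_iff)
    then have "(sgn (?a b))\<^sup>2 = 1" by (simp add: sgn_if)
    ultimately obtain w where w: "(\<Sum>e\<in>D. w e *\<^sub>R rvec e) = rvec b" "sum w D = 1"
      "sum_of_squares ((\<Sum>e\<in>D. Poly_Mapping.single e (w e * c e)) + Poly_Mapping.single b (sgn (?a b) * c b))"
      using halving_sum_of_squares by blast
    \<comment> \<open>Both weight functions are the barycentric coordinates of \<open>b\<close> in the simplex.\<close>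
    have w_eq: "w e = l b (rvec e)" if e: "e \<in> D" for e
    proof -
      have "w (inv rvec (rvec e)) = l b (rvec e)"
        using D l b w e
        by (intro affine_independent_weights_unique [of "rvec ` D" "w \<circ> inv rvec", unfolded o_def])
          (auto simp: sum.reindex [OF inj_D] inv_f_f [OF inj_rvec])
      then show ?thesis by (simp add: inv_f_f [OF inj_rvec])
    qed
    have "sum_of_squares (Poly_Mapping.single 0 (\<bar>?a b\<bar> / c b) *
      ((\<Sum>e\<in>D. Poly_Mapping.single e (w e * c e)) + Poly_Mapping.single b (sgn (?a b) * c b)))"
      using w(3) by (intro sum_of_squares_scale) (auto simp: c_def)
    also have "Poly_Mapping.single 0 (\<bar>?a b\<bar> / c b) *
      ((\<Sum>e\<in>D. Poly_Mapping.single e (w e * c e)) + Poly_Mapping.single b (sgn (?a b) * c b)) =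
      (\<Sum>e\<in>D. Poly_Mapping.single e (r b e)) + Poly_Mapping.single b (?a b)"
      by (simp add: distrib_left sum_distrib_left mult_single r_def w_eq c_def sgn_if abs_if)
    finally show ?thesis .
  qed
  then have sos_Y: "sum_of_squares (\<Sum>b\<in>Y. (\<Sum>e\<in>D. Poly_Mapping.single e (r b e)) + Poly_Mapping.single b (?a b))"
    by (intro sum_of_squares_sum) auto
  have rest: "sum_of_squares (Poly_Mapping.single e (?a e - (\<Sum>b\<in>Y. r b e)))" if e: "e \<in> D" for e
  proof -
    have "(\<Sum>b\<in>Y. r b e) = c e * (\<Sum>b\<in>Y. \<bar>?a b\<bar> * exp (y \<bullet> rvec b) * l b (rvec e))"
      by (simp add: r_def c_def sum_distrib_left exp_minus divide_simps mult_ac)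
    also have "\<dots> \<le> c e * (?a e * exp (y \<bullet> rvec e))"
      using y [OF e] by (intro mult_left_mono) (auto simp: c_def)
    also have "\<dots> = ?a e" by (simp add: c_def exp_minus)
    finally have "?a e - (\<Sum>b\<in>Y. r b e) \<ge> 0" by simp
    moreover obtain u where "e = u + u"
      using D(2) e int_point_even_iff by blast
    ultimately show ?thesis using sum_of_squares_even_term by blast
  qed
  have "f = (\<Sum>e\<in>D. Poly_Mapping.single e (?a e)) + (\<Sum>b\<in>Y. Poly_Mapping.single b (?a b))"
    using poly_mapping_eq_sum_single [of "D \<union> Y" f] D(1) Y(1,3) keys
    by (simp add: sum.union_disjoint Int_commute)
  also have "(\<Sum>e\<in>D. Poly_Mapping.single e (?a e)) =
      (\<Sum>e\<in>D. Poly_Mapping.single e (?a e - (\<Sum>b\<in>Y. r b e))) +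
      (\<Sum>b\<in>Y. \<Sum>e\<in>D. Poly_Mapping.single e (r b e))"
    by (subst sum.swap) (simp flip: sum.distrib single_sum single_add)
  finally have f_eq: "f = (\<Sum>e\<in>D. Poly_Mapping.single e (?a e - (\<Sum>b\<in>Y. r b e))) +
      (\<Sum>b\<in>Y. (\<Sum>e\<in>D. Poly_Mapping.single e (r b e)) + Poly_Mapping.single b (?a b))"
    by (simp add: sum.distrib add.assoc)
  show ?thesis
    by (rule ssubst [OF f_eq, where P = sum_of_squares])
      (intro sum_of_squares_add sum_of_squares_sum rest sos_Y)
qed

theorem theorem3p9:
  fixes \<alpha> :: "nat \<Rightarrow> nat ^ 'n::finite"
    and Y \<Delta> :: "(nat ^ 'n) set"
    and a :: "nat \<Rightarrow> real"
    and b :: "nat ^ 'n \<Rightarrow> real"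
    and f :: "'n mpolynomial"
  assumes Delta: "\<Delta> = \<alpha> ` {..CARD('n)}"
    and Delta_even: "int_point ` \<Delta> \<subseteq> even_lattice"
    and alpha_0: "\<alpha> 0 = 0"
    and alpha_distinct: "inj_on \<alpha> {..CARD('n)}"
    and simplicial: "\<not> affine_dependent (real_point ` int_point ` \<Delta>)"
    and Y_finite: "finite Y"
    and Y_interior:
      "real_point ` int_point ` Y \<subseteq> interior (convex hull (real_point ` int_point ` \<Delta>))"
    and f: "f = (\<Sum>i\<le>CARD('n). Poly_Mapping.single (\<alpha> i) (a i))
              + (\<Sum>\<beta>\<in>Y. Poly_Mapping.single \<beta> (b \<beta>))"
    and f_SONC: "SONC f"
    and f_support: "Poly_Mapping.keys f = \<Delta> \<union> Y"
    and a_pos: "\<And>i. i \<le> CARD('n) \<Longrightarrow> a i > 0"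
    and b_cond: "\<And>\<beta>. \<beta> \<in> Y \<Longrightarrow> b \<beta> < 0 \<or> int_point \<beta> \<notin> even_lattice"
  shows "sum_of_squares f \<longleftrightarrow>
           (\<forall>\<beta>\<in>Y. int_point \<beta> \<in> maximal_mediated (int_point ` \<Delta>))"
proof -
  have fin: "finite \<Delta>" by (simp add: Delta)
  have "x \<notin> interior (convex hull (rvec ` \<Delta>))" if "x \<in> rvec ` \<Delta>" for x
    using that simplicial extreme_point_of_convex_hull_affine_independent [of "rvec ` \<Delta>" x]
    by (intro extreme_point_not_in_interior) (simp add: image_image)
  then have disjoint: "Y \<inter> \<Delta> = {}"
    using Y_interior by (auto simp: image_image)
  have lookup_Y: "Poly_Mapping.lookup f \<beta> = b \<beta>" if "\<beta> \<in> Y" for \<beta>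
  proof -
    have "\<alpha> i \<noteq> \<beta>" if "i \<le> CARD('n)" for i
      using that \<open>\<beta> \<in> Y\<close> disjoint by (auto simp: Delta)
    then show ?thesis
      using that Y_finite by (simp add: f lookup_add lookup_sum lookup_single when_def)
  qed
  have lookup_\<Delta>: "Poly_Mapping.lookup f e > 0" if e: "e \<in> \<Delta>" for e
  proof -
    obtain j where j: "j \<le> CARD('n)" "e = \<alpha> j" using e by (auto simp: Delta)
    have "(\<Sum>i\<le>CARD('n). a i when \<alpha> i = e) = (\<Sum>i\<le>CARD('n). if i = j then a j else 0)"
      using j alpha_distinct by (intro sum.cong) (auto simp: when_def inj_on_def)
    moreover have "(\<Sum>\<beta>\<in>Y. b \<beta> when \<beta> = e) = 0"
      using e disjoint by (intro sum.neutral) (auto simp: when_def)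
    ultimately show ?thesis
      using j a_pos by (simp add: f lookup_add lookup_sum lookup_single)
  qed
  have sign_Y: "Poly_Mapping.lookup f \<beta> < 0 \<or> int_point \<beta> \<notin> even_lattice" if "\<beta> \<in> Y" for \<beta>
    using b_cond [OF that] lookup_Y [OF that] by simp
  show ?thesis
  proof
    assume "sum_of_squares f"
    then have "int_point ` Poly_Mapping.keys f \<subseteq> maximal_mediated (int_point ` \<Delta>)"
      using fin f_support sign_Y by (intro sum_of_squares_keys_mediated) blast+
    then show "\<forall>\<beta>\<in>Y. int_point \<beta> \<in> maximal_mediated (int_point ` \<Delta>)"
      using f_support by blast
  next
    assume "\<forall>\<beta>\<in>Y. int_point \<beta> \<in> maximal_mediated (int_point ` \<Delta>)"
    then have "int_point ` Y \<subseteq> maximal_mediated (int_point ` \<Delta>)" by blast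
    then show "sum_of_squares f"
      using SONC_mediated_sum_of_squares [of \<Delta> Y f, OF fin Delta_even _ Y_finite _ disjoint f_support
          lookup_\<Delta> sign_Y f_SONC] simplicial Y_interior
      by (simp add: image_image)
  qed
qed

end
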